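(* Let $T_n$ denote the Chebyshev polynomial of the first kind of degree $n$. For all integers $n \ge 0$ and $m \ge 1$ and all $x \in [-1,1]$, the $m$-th derivative of $T_n$ is $$T_n^{(m)}(x) = \sum_{\substack{0 \le l \le n-m \\ n+l+m \text{ even}}} \left( \prod_{i \in I_m} \bigl(n^2 - (l+i)^2\bigr) \right) \frac{n}{c_l}\, \frac{1}{(m-1)!\, 2^{m-2}}\, T_l(x),$$ where $I_m = \{2-m,\ 4-m,\ \ldots,\ m-4,\ m-2\}$ for $m > 1$ (the integers from $2-m$ to $m-2$ in steps of two), the product is absent (equal to $1$) for $m = 1$, and $c_0 = 2$, $c_l = 1$ for $l \ge 1$.
   Context: The Chebyshev polynomials of the first kind are defined by $T_n(x) = \cos(n\theta)$ with $x = \cos\theta$, $\theta \in [0,\pi]$, $n \ge 0$. For $m = 2$ the index set is $I_2 = \{0\}$. An empty sum (when $n < m$) equals $0$. For $m=1$ the factor $2^{m-2}$ is $2^{-1}$. *)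

theory Defs
  imports "HOL-Analysis.Analysis" "HOL-Computational_Algebra.Polynomial"
begin

definition cheb_T :: "nat \<Rightarrow> real poly" where
  "cheb_T n = (THE p. \<forall>\<theta>\<in>{0..pi}. poly p (cos \<theta>) = cos (real n * \<theta>))"

lemma cheb_poly_exists:
  "\<exists>p :: real poly. \<forall>\<theta>. poly p (cos \<theta>) = cos (real n * \<theta>)"
proof (induction n rule: less_induct)
  case (less n)
  consider "n = 0" | "n = 1" | k where "n = Suc (Suc k)"
    by (metis One_nat_def not0_implies_Suc)
  then show ?case
  proof cases
    case 1
    have "\<forall>\<theta>. poly [:1:] (cos \<theta>) = cos (real n * \<theta>)" using 1 by simp
    then show ?thesis by blast
  next
    case 2
    have "\<forall>\<theta>. poly [:0, 1:] (cos \<theta>) = cos (real n * \<theta>)" using 2 by simp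
    then show ?thesis by blast
  next
    case 3
    obtain p where p: "poly p (cos \<theta>) = cos (real k * \<theta>)" for \<theta>
      using less.IH[of k] 3 by auto
    obtain q where q: "poly q (cos \<theta>) = cos (real (Suc k) * \<theta>)" for \<theta>
      using less.IH[of "Suc k"] 3 by auto
    have "poly ([:0, 2:] * q - p) (cos \<theta>) = cos (real n * \<theta>)" for \<theta>
    proof -
      have "cos (real n * \<theta>) = cos (real (Suc k) * \<theta> + \<theta>)"
        using 3 by (simp add: algebra_simps)
      moreover have "cos (real k * \<theta>) = cos (real (Suc k) * \<theta> - \<theta>)"
        by (simp add: algebra_simps)
      ultimately show ?thesis
        by (simp only: poly_diff poly_mult p q cos_add cos_diff) simp
    qed
    then show ?thesis by blast
  qed
qed

lemma cheb_poly_unique: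
  fixes p q :: "real poly"
  assumes "\<forall>\<theta>\<in>{0..pi}. poly p (cos \<theta>) = poly q (cos \<theta>)"
  shows "p = q"
proof (rule ccontr)
  assume "p \<noteq> q"
  then have "finite {x. poly (p - q) x = 0}" by (intro poly_roots_finite) simp
  moreover have "{-1..1::real} \<subseteq> {x. poly (p - q) x = 0}"
  proof
    fix x :: real assume "x \<in> {-1..1}"
    then have "cos (arccos x) = x" "arccos x \<in> {0..pi}"
      by (auto simp: arccos_lbound arccos_ubound)
    then show "x \<in> {x. poly (p - q) x = 0}" using assms by force
  qed
  ultimately have "finite {-1..1::real}" by (rule rev_finite_subset)
  then show False by (simp add: infinite_Icc)
qed

lemma cheb_T_cos:
  assumes "\<theta> \<in> {0..pi}"
  shows "poly (cheb_T n) (cos \<theta>) = cos (real n * \<theta>)"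
proof -
  have "\<exists>!p :: real poly. \<forall>\<theta>\<in>{0..pi}. poly p (cos \<theta>) = cos (real n * \<theta>)"
    using cheb_poly_exists[of n] cheb_poly_unique by (metis (no_types, lifting))
  from theI'[OF this] assms show ?thesis unfolding cheb_T_def by blast
qed

text \<open>For \<open>m = 1\<close> this set is empty, so that a product over it is \<open>1\<close>.\<close>
definition idx_set :: "nat \<Rightarrow> int set" where
  "idx_set m = {2 - int m + 2 * int k |k. 2 - int m + 2 * int k \<le> int m - 2}"

lemma finite_idx_set [simp]: "finite (idx_set m)"
  by (rule finite_subset[of _ "{2 - int m..int m - 2}"]) (auto simp: idx_set_def)

lemma idx_set_1: "idx_set 1 = {}" and idx_set_2: "idx_set 2 = {0}"
  by (auto simp: idx_set_def)

definition cheb_c :: "nat \<Rightarrow> real" where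
  "cheb_c l = (if l = 0 then 2 else 1)"

end

theory Submission
  imports Defs
begin

text \<open>
  If \<open>p = \<Sum>l (a l / c l) T\<^sub>l\<close> is a Chebyshev expansion, then \<open>p' = \<Sum>l (b l / c l) T\<^sub>l\<close>
  as soon as \<open>b (l - 1) - b (l + 1) = 2 l (a l)\<close> for \<open>l \<ge> 1\<close> and \<open>b\<close> vanishes from the top
  degree on (\<open>pderiv_cheb_series\<close>). This is summation by parts, based on \<open>T\<^sub>l' = l U\<^sub>l\<^sub>-\<^sub>1\<close> and
  \<open>2 T\<^sub>l = U\<^sub>l - U\<^sub>l\<^sub>-\<^sub>2\<close>, where \<open>U\<close> denotes the Chebyshev polynomials of the second kind.

  It remains to check that the claimed coefficients of the successive derivatives of \<open>T\<^sub>n\<close>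
  satisfy this recurrence. The products for \<open>m + 1\<close> at \<open>l - 1\<close> and at \<open>l + 1\<close> both consist of
  the product for \<open>m\<close> at \<open>l\<close> and one more factor, \<open>n\<^sup>2 - (l - m)\<^sup>2\<close> and \<open>n\<^sup>2 - (l + m)\<^sup>2\<close>
  respectively; these two factors differ by \<open>4 l m\<close>, and \<open>2 m\<close> is the ratio of the
  normalising constants. At the cut-off \<open>l = n - m\<close> the second factor is zero, so that
  truncating the sum at \<open>n - m\<close> is consistent with the recurrence.
\<close>

section \<open>Chebyshev polynomials of both kinds\<close>

lemma cheb_T_eqI:
  assumes "\<And>\<theta>. \<theta> \<in> {0..pi} \<Longrightarrow> poly p (cos \<theta>) = cos (real n * \<theta>)"
  shows "cheb_T n = p"
  by (rule cheb_poly_unique) (simp add: assms cheb_T_cos)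

lemma cheb_T_0: "cheb_T 0 = 1"
  by (rule cheb_T_eqI) simp

lemma cheb_T_1: "cheb_T (Suc 0) = [:0, 1:]"
  by (rule cheb_T_eqI) simp

lemma cheb_T_Suc_Suc: "cheb_T (Suc (Suc n)) = [:0, 2:] * cheb_T (Suc n) - cheb_T n"
proof (rule cheb_T_eqI)
  fix \<theta> :: real
  assume \<theta>: "\<theta> \<in> {0..pi}"
  have "cos (real (Suc (Suc n)) * \<theta>) = cos (real (Suc n) * \<theta> + \<theta>)"
    by (simp add: algebra_simps)
  moreover have "cos (real n * \<theta>) = cos (real (Suc n) * \<theta> - \<theta>)"
    by (simp add: algebra_simps)
  ultimately show "poly ([:0, 2:] * cheb_T (Suc n) - cheb_T n) (cos \<theta>)
      = cos (real (Suc (Suc n)) * \<theta>)"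
    by (simp only: poly_diff poly_mult cheb_T_cos[OF \<theta>] cos_add cos_diff) simp
qed

text \<open>The Chebyshev polynomials of the second kind with the index shifted by one:
  \<open>cheb_V n\<close> is \<open>U\<^sub>n\<^sub>-\<^sub>1\<close>, with \<open>U\<^sub>-\<^sub>1 = 0\<close>.\<close>

fun cheb_V :: "nat \<Rightarrow> real poly" where
  "cheb_V 0 = 0"
| "cheb_V (Suc 0) = 1"
| "cheb_V (Suc (Suc n)) = [:0, 2:] * cheb_V (Suc n) - cheb_V n"

lemma smult_2_cheb_T: "smult 2 (cheb_T (Suc n)) = cheb_V (Suc (Suc n)) - cheb_V n"
proof (induction n rule: less_induct)
  case (less n)
  consider "n = 0" | "n = Suc 0" | k where "n = Suc (Suc k)"
    by (metis not0_implies_Suc)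
  then show ?case
  proof cases
    case 1
    then show ?thesis by (simp add: cheb_T_1)
  next
    case 2
    then show ?thesis by (simp add: cheb_T_Suc_Suc cheb_T_0 cheb_T_1 one_pCons numeral_poly)
  next
    case 3
    have "smult 2 (cheb_T (Suc n)) =
        [:0, 2:] * smult 2 (cheb_T (Suc (Suc k))) - smult 2 (cheb_T (Suc k))"
      unfolding 3 cheb_T_Suc_Suc[of "Suc k"] by (simp add: smult_diff_right)
    also have "\<dots> = [:0, 2:] * (cheb_V (Suc (Suc (Suc k))) - cheb_V (Suc k))
        - (cheb_V (Suc (Suc k)) - cheb_V k)"
      using less.IH[of "Suc k"] less.IH[of k] 3 by (simp only: lessI less_SucI)
    also have "\<dots> = cheb_V (Suc (Suc n)) - cheb_V n"
      unfolding 3 cheb_V.simps(3)[of "Suc (Suc k)"] cheb_V.simps(3)[of k]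
      by (simp only: algebra_simps)
    finally show ?thesis .
  qed
qed

lemma pderiv_cheb_T: "pderiv (cheb_T n) = smult (real n) (cheb_V n)"
proof (induction n rule: less_induct)
  case (less n)
  consider "n = 0" | "n = Suc 0" | k where "n = Suc (Suc k)"
    by (metis not0_implies_Suc)
  then show ?case
  proof cases
    case 1
    then show ?thesis by (simp add: cheb_T_0)
  next
    case 2
    then show ?thesis by (simp add: cheb_T_1 pderiv_pCons)
  next
    case 3
    have "pderiv (cheb_T n) = smult 2 (cheb_T (Suc k))
        + [:0, 2:] * pderiv (cheb_T (Suc k)) - pderiv (cheb_T k)"
      unfolding 3 cheb_T_Suc_Suc by (simp add: pderiv_diff pderiv_mult pderiv_smult pderiv_pCons)
    also have "\<dots> = (cheb_V (Suc (Suc k)) - cheb_V k)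
        + smult (real (Suc k)) ([:0, 2:] * cheb_V (Suc k)) - smult (real k) (cheb_V k)"
      using less.IH[of "Suc k"] less.IH[of k] 3 by (simp add: smult_2_cheb_T)
    also have "[:0, 2:] * cheb_V (Suc k) = cheb_V (Suc (Suc k)) + cheb_V k"
      by simp
    also have "(cheb_V (Suc (Suc k)) - cheb_V k)
        + smult (real (Suc k)) (cheb_V (Suc (Suc k)) + cheb_V k) - smult (real k) (cheb_V k)
        = smult (real n) (cheb_V n)"
      unfolding 3 by (rule poly_eqI) (simp add: algebra_simps del: cheb_V.simps)
    finally show ?thesis .
  qed
qed

section \<open>Differentiating a Chebyshev series\<close>

lemma pderiv_sum: "pderiv (\<Sum>i\<in>A. f i) = (\<Sum>i\<in>A. pderiv (f i))"
  by (induction A rule: infinite_finite_induct) (simp_all add: pderiv_add)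

lemma cheb_series_summation_by_parts:
  fixes a b :: "nat \<Rightarrow> real"
  assumes "\<And>l. b l - b (Suc (Suc l)) = 2 * real (Suc l) * a (Suc l)"
  shows "(\<Sum>l\<le>N. smult (b l / cheb_c l) (cheb_T l)) =
    (\<Sum>l\<le>N. smult (a l / cheb_c l) (pderiv (cheb_T l)))
      + smult (b N / 2) (cheb_V (Suc N)) + smult (b (Suc N) / 2) (cheb_V N)"
proof (induction N)
  case 0
  show ?case by (simp add: cheb_c_def cheb_T_0)
next
  case (Suc N)
  have T: "cheb_T (Suc N) = smult (1/2) (cheb_V (Suc (Suc N)) - cheb_V N)"
    using smult_2_cheb_T[of N] by (metis smult_smult smult_1_left
        mult.commute nonzero_mult_div_cancel_left zero_neq_numeral times_divide_eq_left mult_1)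
  have a: "a (Suc N) * real (Suc N) = (b N - b (Suc (Suc N))) / 2"
    using assms[of N] by (simp add: field_simps)
  have "smult (b N / 2) (cheb_V (Suc N)) + smult (b (Suc N) / 2) (cheb_V N)
      + smult (b (Suc N)) (cheb_T (Suc N)) =
    smult (a (Suc N)) (pderiv (cheb_T (Suc N)))
      + smult (b (Suc N) / 2) (cheb_V (Suc (Suc N)))
      + smult (b (Suc (Suc N)) / 2) (cheb_V (Suc N))"
    unfolding pderiv_cheb_T smult_smult a unfolding T
    by (rule poly_eqI) (simp add: field_simps del: cheb_V.simps)
  with Suc.IH show ?case
    by (simp add: cheb_c_def algebra_simps del: cheb_V.simps)
qed

lemma pderiv_cheb_series:
  fixes a b :: "nat \<Rightarrow> real"
  assumes "\<And>l. b l - b (Suc (Suc l)) = 2 * real (Suc l) * a (Suc l)"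
    and "b N = 0" and "b (Suc N) = 0"
  shows "pderiv (\<Sum>l\<le>N. smult (a l / cheb_c l) (cheb_T l)) =
    (\<Sum>l\<le>N. smult (b l / cheb_c l) (cheb_T l))"
  using cheb_series_summation_by_parts[OF assms(1), of N] assms(2,3)
  by (simp add: pderiv_sum pderiv_smult)

section \<open>The coefficients of the derivatives\<close>

text \<open>The product over the index set \<open>I\<^sub>p\<^sub>+\<^sub>1\<close>, with \<open>l\<close> replaced by a real variable.\<close>

definition cheb_prod :: "nat \<Rightarrow> nat \<Rightarrow> real \<Rightarrow> real" where
  "cheb_prod n p t = (\<Prod>i\<in>idx_set (Suc p). (real n)\<^sup>2 - (t + real_of_int i)\<^sup>2)"

lemma cheb_prod_lessThan:
  "cheb_prod n p t = (\<Prod>k<p. (real n)\<^sup>2 - (t + 1 - real p + 2 * real k)\<^sup>2)"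
proof -
  have "idx_set (Suc p) = (\<lambda>k. 1 - int p + 2 * int k) ` {..<p}"
    by (auto simp: idx_set_def)
  moreover have "inj_on (\<lambda>k. 1 - int p + 2 * int k) {..<p}"
    by (auto simp: inj_on_def)
  ultimately show ?thesis
    unfolding cheb_prod_def by (simp add: prod.reindex algebra_simps)
qed

lemma cheb_prod_0: "cheb_prod n 0 t = 1"
  by (simp add: cheb_prod_lessThan)

lemma cheb_prod_Suc_minus_1:
  "cheb_prod n (Suc p) (t - 1) = ((real n)\<^sup>2 - (t - real (Suc p))\<^sup>2) * cheb_prod n p t"
  unfolding cheb_prod_lessThan prod.lessThan_Suc_shift by (simp add: algebra_simps)

lemma cheb_prod_Suc_plus_1:
  "cheb_prod n (Suc p) (t + 1) = ((real n)\<^sup>2 - (t + real (Suc p))\<^sup>2) * cheb_prod n p t"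
  unfolding cheb_prod_lessThan prod.lessThan_Suc by (simp add: algebra_simps)

text \<open>The coefficient of \<open>T\<^sub>l\<close> in the derivative of order \<open>p + 1\<close> of \<open>T\<^sub>n\<close>, up to the factor
  \<open>1 / c\<^sub>l\<close>. It is defined to be zero outside the range of summation.\<close>

definition cheb_coef :: "nat \<Rightarrow> nat \<Rightarrow> nat \<Rightarrow> real" where
  "cheb_coef n p l = (if l + Suc p \<le> n \<and> even (n + l + Suc p)
     then cheb_prod n p (real l) * (real n / (fact p * 2 powi (int p - 1))) else 0)"

lemma cheb_coef_0_recurrence:
  "cheb_coef n 0 l - cheb_coef n 0 (Suc (Suc l)) =
    2 * real (Suc l) * (if Suc l = n then 1 else 0)"
proof (cases "Suc l = n")
  case False
  then have "(l + 1 \<le> n \<and> even (n + l + 1)) = (l + 3 \<le> n \<and> even (n + l + 3))"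
    by presburger
  then show ?thesis using False by (simp add: cheb_coef_def cheb_prod_0)
qed (auto simp: cheb_coef_def cheb_prod_0)

lemma cheb_coef_Suc_recurrence:
  "cheb_coef n (Suc p) l - cheb_coef n (Suc p) (Suc (Suc l)) =
    2 * real (Suc l) * cheb_coef n p (Suc l)"
proof (cases "Suc l + Suc p \<le> n \<and> even (n + Suc l + Suc p)")
  case True
  define K where "K = real n / (fact (Suc p) * 2 powi (int (Suc p) - 1))"
  have K: "real n / (fact p * 2 powi (int p - 1)) = 2 * real (Suc p) * K"
  proof -
    have "(2::real) powi (int (Suc p) - 1) = 2 * 2 powi (int p - 1)"
      using power_int_add_1'[of "2::real" "int p - 1"] by simp
    then show ?thesis
      unfolding K_def by (simp add: field_simps del: of_nat_Suc)
  qed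
  have A: "cheb_coef n (Suc p) l =
      ((real n)\<^sup>2 - (real (Suc l) - real (Suc p))\<^sup>2) * cheb_prod n p (real (Suc l)) * K"
    using True cheb_prod_Suc_minus_1[of n p "real (Suc l)"] by (simp add: cheb_coef_def K_def)
  have B: "cheb_coef n (Suc p) (Suc (Suc l)) =
      ((real n)\<^sup>2 - (real (Suc l) + real (Suc p))\<^sup>2) * cheb_prod n p (real (Suc l)) * K"
  proof (cases "Suc l + Suc p = n")
    case True
    \<comment> \<open>Here the left-hand side is cut off, and on the right the factor before \<open>cheb_prod\<close> is zero.\<close>
    then have "real n = real (Suc l) + real (Suc p)" by linarith
    then show ?thesis using True by (simp add: cheb_coef_def)
  next
    case False
    \<comment> \<open>By parity \<open>n\<close> exceeds \<open>l + p + 2\<close> by at least two.\<close>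
    with True have "Suc (Suc l) + Suc (Suc p) \<le> n"
      by presburger
    with True show ?thesis
      using cheb_prod_Suc_plus_1[of n p "real (Suc l)"] by (simp add: cheb_coef_def K_def add_ac)
  qed
  have C: "cheb_coef n p (Suc l) = cheb_prod n p (real (Suc l)) * (2 * real (Suc p) * K)"
    using True unfolding K[symmetric] by (simp add: cheb_coef_def)
  show ?thesis
    unfolding A B C by (simp add: power2_eq_square algebra_simps)
next
  case False
  then show ?thesis by (auto simp: cheb_coef_def)
qed

lemma higher_pderiv_cheb_T:
  "(pderiv ^^ Suc p) (cheb_T n) = (\<Sum>l\<le>n. smult (cheb_coef n p l / cheb_c l) (cheb_T l))"
proof (induction p)
  case 0
  \<comment> \<open>\<open>cheb_T n\<close> itself is a Chebyshev series with a single nonzero coefficient, which is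
    \<open>cheb_c n\<close> because of the normalisation by \<open>cheb_c\<close>.\<close>
  define a where "a l = (if l = n then cheb_c n else 0)" for l
  have "cheb_T n = (\<Sum>l\<le>n. if l = n then cheb_T n else 0)"
    by simp
  also have "\<dots> = (\<Sum>l\<le>n. smult (a l / cheb_c l) (cheb_T l))"
    by (rule sum.cong) (auto simp: a_def cheb_c_def)
  finally have T: "cheb_T n = (\<Sum>l\<le>n. smult (a l / cheb_c l) (cheb_T l))" .
  have "pderiv (\<Sum>l\<le>n. smult (a l / cheb_c l) (cheb_T l)) =
      (\<Sum>l\<le>n. smult (cheb_coef n 0 l / cheb_c l) (cheb_T l))"
  proof (rule pderiv_cheb_series)
    show "cheb_coef n 0 l - cheb_coef n 0 (Suc (Suc l)) = 2 * real (Suc l) * a (Suc l)" for l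
      unfolding cheb_coef_0_recurrence by (auto simp: a_def cheb_c_def)
  qed (simp_all add: cheb_coef_def)
  then show ?case
    using T by simp
next
  case (Suc p)
  have "pderiv (\<Sum>l\<le>n. smult (cheb_coef n p l / cheb_c l) (cheb_T l)) =
      (\<Sum>l\<le>n. smult (cheb_coef n (Suc p) l / cheb_c l) (cheb_T l))"
    by (rule pderiv_cheb_series)
      (simp_all add: cheb_coef_Suc_recurrence, simp_all add: cheb_coef_def)
  then show ?case
    using Suc.IH by simp
qed

section \<open>The derivatives as real functions\<close>

lemma higher_deriv_poly:
  fixes p :: "real poly"
  shows "(deriv ^^ m) (poly p) = poly ((pderiv ^^ m) p)"
proof (induction m)
  case (Suc m)
  have "deriv (poly q) = poly (pderiv q)" for q :: "real poly"
    by (rule ext) (rule DERIV_imp_deriv[OF poly_DERIV])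
  then show ?case using Suc.IH by simp
qed simp

theorem mainTheorem1:
  fixes n m :: nat and x :: real
  assumes "m \<ge> 1" and "x \<in> {-1..1}"
  shows "(deriv ^^ m) (poly (cheb_T n)) x =
    (\<Sum>l | l + m \<le> n \<and> even (n + l + m).
       (\<Prod>i\<in>idx_set m. (real n)\<^sup>2 - (real l + real_of_int i)\<^sup>2)
         * (real n / cheb_c l)
         * (1 / (fact (m - 1) * 2 powi (int m - 2)))
         * poly (cheb_T l) x)"
proof -
  obtain p where m: "m = Suc p"
    using assms(1) by (cases m) auto
  have "(deriv ^^ m) (poly (cheb_T n)) x =
      (\<Sum>l\<le>n. cheb_coef n p l / cheb_c l * poly (cheb_T l) x)"
    unfolding higher_deriv_poly m higher_pderiv_cheb_T by (simp add: poly_sum)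
  also have "\<dots> = (\<Sum>l | l + m \<le> n \<and> even (n + l + m).
      cheb_coef n p l / cheb_c l * poly (cheb_T l) x)"
    by (rule sum.mono_neutral_right) (auto simp: m cheb_coef_def)
  also have "\<dots> = (\<Sum>l | l + m \<le> n \<and> even (n + l + m).
       (\<Prod>i\<in>idx_set m. (real n)\<^sup>2 - (real l + real_of_int i)\<^sup>2)
         * (real n / cheb_c l)
         * (1 / (fact (m - 1) * 2 powi (int m - 2)))
         * poly (cheb_T l) x)"
    by (rule sum.cong) (simp_all add: m cheb_coef_def cheb_prod_def field_simps)
  finally show ?thesis .
qed

end
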